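(* Let $X$ be a Hausdorff topological space. Then the group $H(X)$ of all self-homeomorphisms of $X$ is isomorphic, algebraically and topologically (i.e. via a group isomorphism that is a homeomorphism), to a subgroup of the group $H_2(X)$ of invertible continuous binary operations on $X$.
   Context: For topological spaces $Y,Z$, $C(Y,Z)$ is the set of continuous maps $Y\to Z$ with the compact-open topology, generated by the subbase of sets $W(K,U)=\{f: f(K)\subset U\}$, $K\subset Y$ compact, $U\subset Z$ open. $H(X)$ is the group (under composition) of all self-homeomorphisms of $X$, with the compact-open topology (as a subspace of $C(X,X)$). A continuous binary operation on $X$ is a continuous map $f:X^2=X\times X\to X$; the set $C_2(X)=C(X^2,X)$ of these carries the compact-open topology and the operation $(f*\varphi)(t,x)=f(t,\varphi(t,x))$ for $t,x\in X$, with identity element $e(t,x)=x$. An element $f\in C_2(X)$ is invertible if there is $\varphi\in C_2(X)$ with $f*\varphi=\varphi*f=e$. $H_2(X)$ is the group (under $*$) of all invertible elements of $C_2(X)$, with the subspace topology. Subgroups of $H_2(X)$ carry the subspace topology. *)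

theory Defs
  imports "HOL-Analysis.Analysis" "HOL-Algebra.Group"
begin

text \<open>Spaces are values of type \<open>'a topology\<close>, so the underlying set may be any set, including the
  empty one. Maps are taken to be extensional, so that two maps are equal as soon as they agree on
  the underlying set of their domain.\<close>

definition cmaps :: "'a topology \<Rightarrow> 'b topology \<Rightarrow> ('a \<Rightarrow> 'b) set" where
  "cmaps Y Z = {f \<in> extensional (topspace Y). continuous_map Y Z f}"

definition compact_open_topology :: "'a topology \<Rightarrow> 'b topology \<Rightarrow> ('a \<Rightarrow> 'b) topology" where
  "compact_open_topology Y Z =
    topology_generated_by
      {{f \<in> cmaps Y Z. f ` K \<subseteq> U} |K U. compactin Y K \<and> openin Z U}"

lemma topspace_compact_open_topology [simp]:
  "topspace (compact_open_topology Y Z) = cmaps Y Z"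
proof -
  have "cmaps Y Z \<in> {{f \<in> cmaps Y Z. f ` K \<subseteq> U} |K U. compactin Y K \<and> openin Z U}"
    by (rule CollectI, rule exI[of _ "{}"], rule exI[of _ "{}"]) auto
  then show ?thesis
    unfolding compact_open_topology_def topology_generated_by_topspace by blast
qed

definition homeo_group :: "'a topology \<Rightarrow> ('a \<Rightarrow> 'a) monoid" where
  "homeo_group X =
    \<lparr>carrier = {f \<in> cmaps X X. homeomorphic_map X X f},
     mult = compose (topspace X),
     one = (\<lambda>x\<in>topspace X. x)\<rparr>"

definition homeo_topology :: "'a topology \<Rightarrow> ('a \<Rightarrow> 'a) topology" where
  "homeo_topology X = subtopology (compact_open_topology X X) (carrier (homeo_group X))"

definition binop_monoid :: "'a topology \<Rightarrow> ('a \<times> 'a \<Rightarrow> 'a) monoid" where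
  "binop_monoid X =
    \<lparr>carrier = cmaps (prod_topology X X) X,
     mult = (\<lambda>f \<phi>. \<lambda>(t, x)\<in>topspace (prod_topology X X). f (t, \<phi> (t, x))),
     one = (\<lambda>(t, x)\<in>topspace (prod_topology X X). x)\<rparr>"

definition binop_group :: "'a topology \<Rightarrow> ('a \<times> 'a \<Rightarrow> 'a) monoid" where
  "binop_group X = units_of (binop_monoid X)"

definition binop_topology :: "'a topology \<Rightarrow> ('a \<times> 'a \<Rightarrow> 'a) topology" where
  "binop_topology X =
    subtopology (compact_open_topology (prod_topology X X) X) (carrier (binop_group X))"

lemma continuous_map_restrict_iff:
  "continuous_map X Y (restrict f (topspace X)) \<longleftrightarrow> continuous_map X Y f"
  by (rule iffI; erule continuous_map_eq; simp)

lemma homeomorphic_map_restrict_iff: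
  "homeomorphic_map X Y (restrict f (topspace X)) \<longleftrightarrow> homeomorphic_map X Y f"
  by (rule iffI; erule homeomorphic_map_eq; simp)

lemma group_homeo_group: "group (homeo_group X)"
proof (rule groupI)
  fix f g assume "f \<in> carrier (homeo_group X)" "g \<in> carrier (homeo_group X)"
  then have h: "homeomorphic_map X X (f \<circ> g)"
    by (auto simp: homeo_group_def intro: homeomorphic_map_compose)
  have "compose (topspace X) f g = restrict (f \<circ> g) (topspace X)"
    by (auto simp: compose_def)
  with h show "f \<otimes>\<^bsub>homeo_group X\<^esub> g \<in> carrier (homeo_group X)"
    by (simp add: homeo_group_def cmaps_def homeomorphic_map_restrict_iff
        homeomorphic_imp_continuous_map)
next
  show "\<one>\<^bsub>homeo_group X\<^esub> \<in> carrier (homeo_group X)"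
    using homeomorphic_map_id[of X]
    by (simp add: homeo_group_def cmaps_def homeomorphic_map_restrict_iff
        continuous_map_restrict_iff id_def)
next
  fix f g h
  assume "f \<in> carrier (homeo_group X)" "g \<in> carrier (homeo_group X)" "h \<in> carrier (homeo_group X)"
  then have "h \<in> topspace X \<rightarrow> topspace X"
    by (auto simp: homeo_group_def cmaps_def continuous_map_def)
  then show "f \<otimes>\<^bsub>homeo_group X\<^esub> g \<otimes>\<^bsub>homeo_group X\<^esub> h
      = f \<otimes>\<^bsub>homeo_group X\<^esub> (g \<otimes>\<^bsub>homeo_group X\<^esub> h)"
    by (simp add: homeo_group_def compose_assoc)
next
  fix f assume "f \<in> carrier (homeo_group X)"
  then show "\<one>\<^bsub>homeo_group X\<^esub> \<otimes>\<^bsub>homeo_group X\<^esub> f = f"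
    by (auto simp: homeo_group_def cmaps_def continuous_map_def intro!: Id_compose)
next
  fix f assume f: "f \<in> carrier (homeo_group X)"
  then obtain g where g: "homeomorphic_maps X X f g"
    by (auto simp: homeo_group_def homeomorphic_map_maps)
  then have "homeomorphic_map X X g"
    using homeomorphic_maps_map by blast
  then have "restrict g (topspace X) \<in> carrier (homeo_group X)"
    by (simp add: homeo_group_def cmaps_def homeomorphic_map_restrict_iff
        continuous_map_restrict_iff homeomorphic_imp_continuous_map)
  moreover have "compose (topspace X) (restrict g (topspace X)) f = (\<lambda>x\<in>topspace X. x)"
    using g by (auto simp: fun_eq_iff compose_def homeomorphic_maps_def continuous_map_def Pi_iff)
  ultimately show "\<exists>g\<in>carrier (homeo_group X). g \<otimes>\<^bsub>homeo_group X\<^esub> f = \<one>\<^bsub>homeo_group X\<^esub>"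
    by (auto simp: homeo_group_def)
qed

lemma monoid_binop_monoid: "monoid (binop_monoid X)"
proof
  fix f g
  assume "f \<in> carrier (binop_monoid X)" "g \<in> carrier (binop_monoid X)"
  then have f: "continuous_map (prod_topology X X) X f" and g: "continuous_map (prod_topology X X) X g"
    by (auto simp: binop_monoid_def cmaps_def)
  have "continuous_map (prod_topology X X) X (f \<circ> (\<lambda>p. (fst p, g p)))"
    using f g
    by (intro continuous_map_compose[where X' = "prod_topology X X"])
       (auto simp: continuous_map_pairwise o_def continuous_map_fst)
  then have "continuous_map (prod_topology X X) X (\<lambda>(t, x). f (t, g (t, x)))"
    by (simp add: o_def case_prod_unfold)
  then show "f \<otimes>\<^bsub>binop_monoid X\<^esub> g \<in> carrier (binop_monoid X)"
    using continuous_map_restrict_iff[of "prod_topology X X" X]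
    by (simp add: binop_monoid_def cmaps_def)
next
  show "\<one>\<^bsub>binop_monoid X\<^esub> \<in> carrier (binop_monoid X)"
    using continuous_map_restrict_iff[of "prod_topology X X" X snd] continuous_map_snd[of X X]
    by (simp add: binop_monoid_def cmaps_def case_prod_unfold)
next
  fix f g h
  assume "h \<in> carrier (binop_monoid X)"
  then have "h (t, x) \<in> topspace X" if "t \<in> topspace X" "x \<in> topspace X" for t x
    using that by (auto simp: binop_monoid_def cmaps_def continuous_map_def)
  then show "f \<otimes>\<^bsub>binop_monoid X\<^esub> g \<otimes>\<^bsub>binop_monoid X\<^esub> h
      = f \<otimes>\<^bsub>binop_monoid X\<^esub> (g \<otimes>\<^bsub>binop_monoid X\<^esub> h)"
    by (auto simp: binop_monoid_def fun_eq_iff restrict_def)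
next
  fix f
  assume "f \<in> carrier (binop_monoid X)"
  then have f: "f (t, x) \<in> topspace X" if "t \<in> topspace X" "x \<in> topspace X" for t x
    using that by (auto simp: binop_monoid_def cmaps_def continuous_map_def)
  have e: "f \<in> extensional (topspace X \<times> topspace X)"
    using \<open>f \<in> carrier (binop_monoid X)\<close> by (simp add: binop_monoid_def cmaps_def)
  show "\<one>\<^bsub>binop_monoid X\<^esub> \<otimes>\<^bsub>binop_monoid X\<^esub> f = f"
    by (rule extensionalityI[OF _ e]) (auto simp: binop_monoid_def f)
  show "f \<otimes>\<^bsub>binop_monoid X\<^esub> \<one>\<^bsub>binop_monoid X\<^esub> = f"
    by (rule extensionalityI[OF _ e]) (auto simp: binop_monoid_def)
qed

lemma group_binop_group: "group (binop_group X)"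
  unfolding binop_group_def by (rule monoid.units_group[OF monoid_binop_monoid])

end

theory Submission
  imports Defs
begin

text \<open>A homeomorphism \<open>f\<close> is turned into the binary operation \<open>(t, x) \<mapsto> f x\<close>, that is,
  \<open>f\<close> precomposed with the second projection \<open>X \<times> X \<rightarrow> X\<close>. For operations that ignore \<open>t\<close> the
  product \<open>*\<close> is composition in \<open>x\<close>, so this is a homomorphism from \<open>H(X)\<close> to the monoid of binary
  operations; since it is defined on a group, its values are invertible (\<open>hom_units_of\<close>).

  Topologically, precomposition with a continuous map is continuous for the compact-open topology,
  because continuous images of compact sets are compact. The second projection has a continuous
  right inverse, the diagonal \<open>x \<mapsto> (x, x)\<close>, so precomposition with the projection has a continuous
  left inverse and is an embedding (\<open>embedding_map_precompose\<close>); in particular it is injective.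
  Using the diagonal, instead of \<open>x \<mapsto> (t\<^sub>0, x)\<close>, avoids the choice of a point and so covers the
  empty space as well.\<close>

lemma compose_cmaps:
  assumes "continuous_map E Y p" "f \<in> cmaps Y Z"
  shows "compose (topspace E) f p \<in> cmaps E Z"
proof -
  have "continuous_map E Z (f \<circ> p)"
    using assms by (auto simp: cmaps_def intro: continuous_map_compose)
  then show ?thesis
    using continuous_map_restrict_iff[of E Z "f \<circ> p"] by (simp add: cmaps_def compose_def o_def)
qed

text \<open>The preimage of a subbasic set \<open>W(K, U)\<close> under precomposition with \<open>p\<close> is the subbasic set
  \<open>W(p(K), U)\<close>, as \<open>p(K)\<close> is again compact.\<close>

lemma continuous_map_precompose:
  assumes p: "continuous_map E Y p"
  shows "continuous_map (compact_open_topology Y Z) (compact_open_topology E Z)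
           (\<lambda>f. compose (topspace E) f p)"
proof -
  let ?P = "\<lambda>f. compose (topspace E) f p"
  have "openin (compact_open_topology Y Z) (?P -` W \<inter> topspace (compact_open_topology Y Z))"
    if sub: "W \<in> {{f \<in> cmaps E Z. f ` K \<subseteq> U} |K U. compactin E K \<and> openin Z U}" for W
  proof -
    obtain K U where K: "compactin E K" and U: "openin Z U"
      and W: "W = {f \<in> cmaps E Z. f ` K \<subseteq> U}"
      using sub by blast
    have "?P f \<in> W \<longleftrightarrow> f ` p ` K \<subseteq> U" if "f \<in> cmaps Y Z" for f
      using compose_cmaps[OF p that] compactin_subset_topspace[OF K]
      by (auto simp: W compose_def image_subset_iff subset_eq)
    then have "?P -` W \<inter> topspace (compact_open_topology Y Z) = {f \<in> cmaps Y Z. f ` p ` K \<subseteq> U}"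
      by auto
    moreover have "compactin Y (p ` K)"
      using K p by (rule image_compactin)
    ultimately have "?P -` W \<inter> topspace (compact_open_topology Y Z)
        \<in> {{f \<in> cmaps Y Z. f ` K \<subseteq> U} |K U. compactin Y K \<and> openin Z U}"
      using U by blast
    then show ?thesis
      unfolding compact_open_topology_def[of Y Z] by (rule topology_generated_by_Basis)
  qed
  moreover have "?P ` topspace (compact_open_topology Y Z) \<subseteq> topspace (compact_open_topology E Z)"
    using compose_cmaps[OF p, where Z = Z] by auto
  ultimately show ?thesis
    unfolding compact_open_topology_def[of E Z] topology_generated_by_topspace
    by (rule continuous_on_generated_topo)
qed

text \<open>Contravariance: a right inverse \<open>s\<close> of \<open>p\<close> induces a left inverse of precomposition with \<open>p\<close>.\<close>

lemma embedding_map_precompose: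
  assumes ps: "retraction_maps E Y p s"
  shows "embedding_map (compact_open_topology Y Z) (compact_open_topology E Z)
           (\<lambda>f. compose (topspace E) f p)"
proof -
  have p: "continuous_map E Y p" and s: "continuous_map Y E s"
    and id: "\<And>y. y \<in> topspace Y \<Longrightarrow> p (s y) = y"
    using ps by (auto simp: retraction_maps_def)
  have "compose (topspace Y) (compose (topspace E) f p) s = f" if "f \<in> cmaps Y Z" for f
  proof (rule extensionalityI[of _ "topspace Y"])
    show "f \<in> extensional (topspace Y)"
      using that by (simp add: cmaps_def)
    show "compose (topspace Y) (compose (topspace E) f p) s y = f y" if "y \<in> topspace Y" for y
      using that s id by (auto simp: compose_def continuous_map_def)
  qed auto
  then have "retraction_maps (compact_open_topology E Z) (compact_open_topology Y Z)
      (\<lambda>h. compose (topspace Y) h s) (\<lambda>f. compose (topspace E) f p)"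
    using continuous_map_precompose[OF p, of Z] continuous_map_precompose[OF s, of Z]
    by (simp add: retraction_maps_def)
  then show ?thesis
    by (intro section_imp_embedding_map) (auto simp: section_map_def)
qed

text \<open>An invertible element has an invertible image, because homomorphisms preserving the unit
  preserve inverses.\<close>

lemma hom_units_of:
  assumes "group G" "h \<in> hom G M" "h \<one>\<^bsub>G\<^esub> = \<one>\<^bsub>M\<^esub>"
  shows "h \<in> hom G (units_of M)"
proof -
  interpret G: group G by fact
  have "h a \<in> Units M" if a: "a \<in> carrier G" for a
  proof -
    have "h (inv\<^bsub>G\<^esub> a) \<otimes>\<^bsub>M\<^esub> h a = \<one>\<^bsub>M\<^esub>" "h a \<otimes>\<^bsub>M\<^esub> h (inv\<^bsub>G\<^esub> a) = \<one>\<^bsub>M\<^esub>"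
      using a assms(2,3) by (simp_all flip: hom_mult)
    then show ?thesis
      using a assms(2) by (auto simp: Units_def hom_in_carrier)
  qed
  then show ?thesis
    using assms(2) by (auto simp: hom_def units_of_def)
qed

lemma retraction_maps_snd_diagonal:
  "retraction_maps (prod_topology X X) X snd (\<lambda>x. (x, x))"
  by (simp add: retraction_maps_def continuous_map_snd continuous_map_pairwise o_def)

lemma compose_snd_hom_binop_group:
  "(\<lambda>f. compose (topspace (prod_topology X X)) f snd) \<in> hom (homeo_group X) (binop_group X)"
  unfolding binop_group_def
proof (rule hom_units_of[OF group_homeo_group])
  let ?P = "\<lambda>f. compose (topspace (prod_topology X X)) f snd"
  show "?P \<in> hom (homeo_group X) (binop_monoid X)"
  proof (rule homI)
    fix f assume "f \<in> carrier (homeo_group X)"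
    then show "?P f \<in> carrier (binop_monoid X)"
      using compose_cmaps[OF continuous_map_snd, of f X X X]
      by (simp add: homeo_group_def binop_monoid_def)
  next
    fix f g assume "f \<in> carrier (homeo_group X)" "g \<in> carrier (homeo_group X)"
    then have "g x \<in> topspace X" if "x \<in> topspace X" for x
      using that by (auto simp: homeo_group_def cmaps_def continuous_map_def)
    then show "?P (f \<otimes>\<^bsub>homeo_group X\<^esub> g) = ?P f \<otimes>\<^bsub>binop_monoid X\<^esub> ?P g"
      by (auto simp: homeo_group_def binop_monoid_def compose_def fun_eq_iff)
  qed
  show "?P \<one>\<^bsub>homeo_group X\<^esub> = \<one>\<^bsub>binop_monoid X\<^esub>"
    by (auto simp: homeo_group_def binop_monoid_def compose_def fun_eq_iff)
qed

theorem proposition2: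
  fixes X :: "'a topology"
  assumes "Hausdorff_space X"
  shows "\<exists>S \<Phi>. subgroup S (binop_group X) \<and>
    \<Phi> \<in> iso (homeo_group X) (binop_group X\<lparr>carrier := S\<rparr>) \<and>
    homeomorphic_map (homeo_topology X) (subtopology (binop_topology X) S) \<Phi>"
proof -
  define P where "P = (\<lambda>f :: 'a \<Rightarrow> 'a. compose (topspace (prod_topology X X)) f snd)"
  let ?H = "carrier (homeo_group X)"
  let ?S = "P ` ?H"
  have "P \<in> hom (homeo_group X) (binop_group X)"
    unfolding P_def by (rule compose_snd_hom_binop_group)
  then interpret group_hom "homeo_group X" "binop_group X" P
    by (simp add: group_hom_def group_hom_axioms_def group_homeo_group group_binop_group)
  have H: "?H \<subseteq> cmaps X X"
    by (auto simp: homeo_group_def)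
  have emb: "embedding_map (compact_open_topology X X) (compact_open_topology (prod_topology X X) X) P"
    unfolding P_def by (rule embedding_map_precompose[OF retraction_maps_snd_diagonal])
  \<comment> \<open>\<open>?S\<close> inherits the same topology from the image of \<open>P\<close>, which the embedding provides, and from
    the group of invertible operations, because it lies in both.\<close>
  have "homeomorphic_map (homeo_topology X)
      (subtopology (subtopology (compact_open_topology (prod_topology X X) X) (P ` cmaps X X)) ?S) P"
    unfolding homeo_topology_def
  proof (rule homeomorphic_map_subtopologies)
    show "homeomorphic_map (compact_open_topology X X)
        (subtopology (compact_open_topology (prod_topology X X) X) (P ` cmaps X X)) P"
      using emb by (simp add: embedding_map_def)
    show "P ` (topspace (compact_open_topology X X) \<inter> ?H) =
        topspace (subtopology (compact_open_topology (prod_topology X X) X) (P ` cmaps X X)) \<inter> ?S"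
      using H compose_cmaps[OF continuous_map_snd, of _ X X X] by (auto simp: P_def)
  qed
  moreover have "P ` cmaps X X \<inter> ?S = carrier (binop_group X) \<inter> ?S"
    using H by auto
  ultimately have homeo: "homeomorphic_map (homeo_topology X) (subtopology (binop_topology X) ?S) P"
    by (simp add: binop_topology_def subtopology_subtopology)
  have "inj_on P ?H"
    using homeomorphic_imp_injective_map[OF emb[unfolded embedding_map_def]] H
    by (simp add: inj_on_subset)
  then have "P \<in> iso (homeo_group X) (binop_group X\<lparr>carrier := ?S\<rparr>)"
    using homh by (auto simp: iso_def hom_def bij_betw_def)
  with homeo img_is_subgroup show ?thesis
    by blast
qed

end
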